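(* Let $F$ be a formal group law over a commutative ring $R$, and suppose that $[n]_F(t)\in R[[t]]$ is not a zero-divisor for any $n>0$. Then the function $s:\mathbf{Z}_{\ge 0}\to R[[t]]$, $s(n)=[n]_F(t)$, is a generalized $n$-series over $R[[t]]$. Similarly, the function $s_F:\mathbf{Z}_{\ge 0}\to R[[t]]$, $s_F(n)=\langle n\rangle_F(t)$, is a generalized $n$-series over $R[[t]]$.
   Context: A (one-dimensional) formal group law over $R$ is $F(x,y)=x+_Fy\in R[[x,y]]$ with $F(F(x,y),z)=F(x,F(y,z))$ and $F(x,y)\equiv x+y\pmod{(x,y)^2}$. $[n]_F(t)=t+_F\cdots+_Ft$ ($n$ times), which is divisible by $t$, and $\langle n\rangle_F(t)=[n]_F(t)/t$ (with $\langle 0\rangle_F=0$). A generalized $n$-series over a commutative ring $S$ is a function $s:\mathbf{Z}_{\ge 0}\to S$ with $s(0)=0$, $s(n)$ not a zero-divisor for any $n>0$, and $s(n-k)\mid s(n)-s(k)$ for all $n>k>0$. *)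

theory Defs
  imports "HOL-Computational_Algebra.Formal_Power_Series"
begin

unbundle fps_syntax

text \<open>
  Power series in several variables are iterated formal power series, the first variable being
  the outermost one: the coefficient of \<open>x\<^sup>i y\<^sup>j\<close> in \<open>F :: 'a fps fps\<close> is \<open>F $ i $ j\<close>, and the
  coefficient of \<open>x\<^sup>i y\<^sup>j z\<^sup>k\<close> in \<open>G :: 'a fps fps fps\<close> is \<open>G $ i $ j $ k\<close>. Hence the variables
  \<open>x, y\<close> of \<open>R[[x,y]]\<close> are \<open>fps_X, fps_const fps_X\<close>, and the variables \<open>x, y, z\<close> of \<open>R[[x,y,z]]\<close>
  are \<open>fps_X, fps_const fps_X, fps_const (fps_const fps_X)\<close>.

  For \<open>F = \<Sum> a\<^bsub>ij\<^esub> x\<^sup>i y\<^sup>j\<close> and series \<open>g, h\<close> without constant term, every monomial occurring in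
  \<open>g\<^sup>i h\<^sup>j\<close> has total degree at least \<open>i + j\<close>. So a coefficient of \<open>F(g,h) = \<Sum> a\<^bsub>ij\<^esub> g\<^sup>i h\<^sup>j\<close> at a
  monomial of total degree \<open>d\<close> only involves the finitely many terms with \<open>i + j \<le> d\<close>. The two
  substitutions below are meaningful only for \<open>g, h\<close> without constant term.
\<close>

definition subst_fps1 ::
    "'a::comm_ring_1 fps fps \<Rightarrow> 'a fps \<Rightarrow> 'a fps \<Rightarrow> 'a fps" where
  "subst_fps1 F g h =
     Abs_fps (\<lambda>n. \<Sum>(i, j)\<in>{(i, j). i + j \<le> n}. F $ i $ j * (g ^ i * h ^ j) $ n)"

definition subst_fps3 ::
    "'a::comm_ring_1 fps fps \<Rightarrow> 'a fps fps fps \<Rightarrow> 'a fps fps fps \<Rightarrow> 'a fps fps fps" where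
  "subst_fps3 F g h =
     Abs_fps (\<lambda>l. Abs_fps (\<lambda>m. Abs_fps (\<lambda>n.
       \<Sum>(i, j)\<in>{(i, j). i + j \<le> l + m + n}. F $ i $ j * (g ^ i * h ^ j) $ l $ m $ n)))"

definition ideal_xy_squared :: "'a::comm_ring_1 fps fps set" where
  "ideal_xy_squared =
     (let x = fps_X; y = fps_const fps_X
      in {a * x\<^sup>2 + b * (x * y) + c * y\<^sup>2 | a b c. True})"

definition formal_group_law :: "'a::comm_ring_1 fps fps \<Rightarrow> bool" where
  "formal_group_law F \<longleftrightarrow>
     (let x = fps_X; y = fps_const fps_X; z = fps_const (fps_const fps_X)
      in subst_fps3 F (subst_fps3 F x y) z = subst_fps3 F x (subst_fps3 F y z)) \<and>
     (let x = fps_X; y = fps_const fps_X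
      in F - (x + y) \<in> ideal_xy_squared)"

text \<open>\<open>fgl_mult F n\<close> is \<open>[n]\<^sub>F(t) = t +\<^sub>F \<dots> +\<^sub>F t\<close>, bracketed to the left.\<close>

fun fgl_mult :: "'a::comm_ring_1 fps fps \<Rightarrow> nat \<Rightarrow> 'a fps" where
  "fgl_mult F 0 = 0"
| "fgl_mult F (Suc 0) = fps_X"
| "fgl_mult F (Suc (Suc n)) = subst_fps1 F (fgl_mult F (Suc n)) fps_X"

text \<open>\<open>fgl_angle F n\<close> is \<open>\<langle>n\<rangle>\<^sub>F(t) = [n]\<^sub>F(t) / t\<close>; the shift is exact division by \<open>t\<close> because
  \<open>[n]\<^sub>F(t)\<close> has no constant term, see \<open>fps_X_mult_fgl_angle\<close> below.\<close>

definition fgl_angle :: "'a::comm_ring_1 fps fps \<Rightarrow> nat \<Rightarrow> 'a fps" where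
  "fgl_angle F n = fps_shift 1 (fgl_mult F n)"

definition non_zero_divisor :: "'a::comm_ring_1 \<Rightarrow> bool" where
  "non_zero_divisor a \<longleftrightarrow> (\<forall>b. a * b = 0 \<longrightarrow> b = 0)"

definition generalized_n_series :: "(nat \<Rightarrow> 'a::comm_ring_1) \<Rightarrow> bool" where
  "generalized_n_series s \<longleftrightarrow>
     s 0 = 0 \<and>
     (\<forall>n>0. non_zero_divisor (s n)) \<and>
     (\<forall>n k. n > k \<and> k > 0 \<longrightarrow> s (n - k) dvd s n - s k)"

lemma fgl_mult_nth_0:
  assumes "formal_group_law F"
  shows "fgl_mult F n $ 0 = 0"
proof -
  have "F $ 0 $ 0 = 0"
  proof -
    obtain a b c where "F - (fps_X + fps_const fps_X)
        = a * fps_X\<^sup>2 + b * (fps_X * fps_const fps_X) + c * (fps_const fps_X)\<^sup>2"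
      using assms by (auto simp: formal_group_law_def ideal_xy_squared_def Let_def)
    then have "(F - (fps_X + fps_const fps_X)) $ 0 $ 0
        = (a * fps_X\<^sup>2 + b * (fps_X * fps_const fps_X) + c * (fps_const fps_X)\<^sup>2) $ 0 $ 0"
      by simp
    then show ?thesis by (simp add: power2_eq_square)
  qed
  then show ?thesis
    by (induction F n rule: fgl_mult.induct) (auto simp: subst_fps1_def)
qed

lemma fps_X_mult_fgl_angle:
  assumes "formal_group_law F"
  shows "fps_X * fgl_angle F n = fgl_mult F n"
  using fgl_mult_nth_0[OF assms, of n]
  by (intro fps_ext) (auto simp: fgl_angle_def)

end

theory Submission
  imports Defs
begin

text \<open>
  The key identity is \<open>[n] = [n-k] +\<^sub>F [k]\<close> for \<open>0 < k < n\<close>, a consequence of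
  associativity (\<open>fgl_mult_add\<close>). Combined with \<open>F(0,y) = y\<close> it gives divisibility at once: write
  \<open>F(x,y) = F(0,y) + x G(x,y) = y + x G(x,y)\<close> and substitute to get
  \<open>[n] - [k] = [n-k] \<cdot> G([n-k], [k])\<close>. Dividing this relation by \<open>t\<close> gives the divisibility for
  \<open>\<langle>n\<rangle>\<close>, and \<open>\<langle>n\<rangle>\<close> is not a zero-divisor because its multiple \<open>[n] = t\<langle>n\<rangle>\<close> is not.

  The unit law \<open>F(0,y) = y\<close> is itself a consequence of associativity. The series \<open>p(y) = F(0,y)\<close>
  has the form \<open>y + \<dots>\<close>, and \<open>F(F(0,0),y) = F(0,F(0,y))\<close> says \<open>p(y) = p(p(y))\<close>; comparing
  lowest terms of \<open>p - y\<close> forces \<open>p = y\<close> (\<open>idempotent_fps_eq_X\<close>).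

  The real work is to pass from the associativity law, an identity in \<open>R[[x,y,z]]\<close>, to associativity
  of \<open>+\<^sub>F\<close> on series in \<open>R[[t]]\<close> without constant term (\<open>subst_fps1_assoc\<close>). For this one needs
  the evaluation map \<open>R[[x,y,z]] \<rightarrow> R[[t]]\<close>, \<open>x,y,z \<mapsto> f,g,h\<close>. It is a ring homomorphism, and it is
  continuous: series of total degree at least \<open>d\<close> go to series of order at least \<open>d\<close>. Continuity is
  what makes it commute with the infinite sum \<open>\<Sum> a\<^bsub>ij\<^esub> u\<^sup>i v\<^sup>j\<close> that defines \<open>F(u,v)\<close>
  (\<open>eval3_subst_fps3\<close>).
\<close>

section \<open>Evaluation of power series at a series without constant term\<close>

definition unital_ring_hom :: "('b::comm_ring_1 \<Rightarrow> 'c::comm_ring_1) \<Rightarrow> bool" where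
  "unital_ring_hom \<phi> \<longleftrightarrow>
     \<phi> 1 = 1 \<and> (\<forall>a b. \<phi> (a + b) = \<phi> a + \<phi> b) \<and> (\<forall>a b. \<phi> (a * b) = \<phi> a * \<phi> b)"

lemma unital_ring_homD:
  assumes "unital_ring_hom \<phi>"
  shows "\<phi> 0 = 0" "\<phi> 1 = 1" "\<phi> (a + b) = \<phi> a + \<phi> b" "\<phi> (a * b) = \<phi> a * \<phi> b"
    "\<phi> (a ^ n) = \<phi> a ^ n" "\<phi> (sum f A) = (\<Sum>i\<in>A. \<phi> (f i))"
proof -
  show add: "\<And>a b. \<phi> (a + b) = \<phi> a + \<phi> b" and mult: "\<And>a b. \<phi> (a * b) = \<phi> a * \<phi> b"
    and one: "\<phi> 1 = 1"
    using assms by (auto simp: unital_ring_hom_def)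
  show zero: "\<phi> 0 = 0" using add[of 0 0] by simp
  show "\<phi> (a ^ n) = \<phi> a ^ n" by (induction n) (auto simp: mult one)
  show "\<phi> (sum f A) = (\<Sum>i\<in>A. \<phi> (f i))"
    by (induction A rule: infinite_finite_induct) (auto simp: add zero)
qed

lemma unital_ring_hom_fps_const: "unital_ring_hom (fps_const :: 'a::comm_ring_1 \<Rightarrow> 'a fps)"
  by (auto simp: unital_ring_hom_def)

lemma fps_mult_power_nth_eq_0:
  fixes g :: "'a::comm_ring_1 fps"
  assumes "g $ 0 = 0" "n < i"
  shows "(c * g ^ i) $ n = 0"
  using startsby_zero_power_prefix[OF assms(1), rule_format] assms(2)
  by (auto simp: fps_mult_nth intro!: sum.neutral)

text \<open>
  Products of truncated series produce sums over squares of indices, whereas substitution into a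
  power series is defined by sums over triangles.
\<close>

lemma sum_eq_sum_triangle:
  fixes f :: "nat \<Rightarrow> nat \<Rightarrow> 'a::comm_monoid_add"
  assumes "finite S" "{(i, j). i + j \<le> n} \<subseteq> S" "\<And>i j. n < i + j \<Longrightarrow> f i j = 0"
  shows "(\<Sum>(i, j)\<in>S. f i j) = (\<Sum>(i, j)\<in>{(i, j). i + j \<le> n}. f i j)"
proof (rule sum.mono_neutral_right[OF assms(1,2)], rule ballI)
  fix p assume "p \<in> S - {(i, j). i + j \<le> n}"
  then show "(case p of (i, j) \<Rightarrow> f i j) = 0"
    using assms(3)[of "fst p" "snd p"] by (cases p) auto
qed

text \<open>
  The series \<open>\<Sum> \<phi>(G\<^sub>i) g\<^sup>i\<close>. The map \<open>\<phi>\<close> on coefficients is a parameter so that evaluation of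
  iterated power series is iterated evaluation, with \<open>\<phi>\<close> evaluating the inner variables.
\<close>

definition fps_eval :: "('b::comm_ring_1 \<Rightarrow> 'a::comm_ring_1 fps) \<Rightarrow> 'a fps \<Rightarrow> 'b fps \<Rightarrow> 'a fps" where
  "fps_eval \<phi> g G = Abs_fps (\<lambda>n. \<Sum>i\<le>n. (\<phi> (G $ i) * g ^ i) $ n)"

text \<open>
  Being able to truncate several series at the same \<open>N\<close> turns identities between evaluations into
  identities between finite sums.
\<close>

lemma fps_eval_nth:
  assumes "g $ 0 = 0" "n \<le> N"
  shows "fps_eval \<phi> g G $ n = (\<Sum>i\<le>N. \<phi> (G $ i) * g ^ i) $ n"
proof -
  have "(\<Sum>i\<le>n. (\<phi> (G $ i) * g ^ i) $ n) = (\<Sum>i\<le>N. (\<phi> (G $ i) * g ^ i) $ n)"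
    using assms by (intro sum.mono_neutral_left) (auto simp: fps_mult_power_nth_eq_0)
  then show ?thesis by (simp add: fps_eval_def fps_sum_nth)
qed

lemma fps_eval_const:
  assumes "unital_ring_hom \<phi>"
  shows "fps_eval \<phi> g (fps_const c) = \<phi> c"
proof (rule fps_ext)
  fix n
  have "(\<Sum>i\<le>n. (\<phi> (fps_const c $ i) * g ^ i) $ n) = (\<Sum>i\<in>{0}. (\<phi> (fps_const c $ i) * g ^ i) $ n)"
    by (rule sum.mono_neutral_right) (auto simp: unital_ring_homD(1)[OF assms])
  then show "fps_eval \<phi> g (fps_const c) $ n = \<phi> c $ n" by (simp add: fps_eval_def)
qed

lemma fps_eval_X:
  assumes "unital_ring_hom \<phi>" "g $ 0 = 0"
  shows "fps_eval \<phi> g fps_X = g"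
proof (rule fps_ext)
  fix n
  have "fps_eval \<phi> g fps_X $ n = (\<Sum>i\<le>Suc n. \<phi> (fps_X $ i) * g ^ i) $ n"
    using assms by (intro fps_eval_nth) auto
  also have "(\<Sum>i\<le>Suc n. \<phi> (fps_X $ i) * g ^ i) = (\<Sum>i\<in>{1}. \<phi> (fps_X $ i) * g ^ i)"
    by (rule sum.mono_neutral_right) (auto simp: unital_ring_homD(1)[OF assms(1)] fps_X_def)
  finally show "fps_eval \<phi> g fps_X $ n = g $ n" by (simp add: unital_ring_homD[OF assms(1)])
qed

text \<open>
  In degree \<open>n\<close> both sides are sums over pairs \<open>(i, j)\<close>; the pairs with \<open>i + j > n\<close>, which only the
  product of the two truncations has, contribute nothing because \<open>g\<^bsup>i+j\<^esup>\<close> has order at least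
  \<open>i + j\<close>.
\<close>

lemma fps_eval_mult:
  assumes hom: "unital_ring_hom \<phi>" and g: "g $ 0 = 0"
  shows "fps_eval \<phi> g (G * H) = fps_eval \<phi> g G * fps_eval \<phi> g H"
proof (rule fps_ext)
  fix n
  let ?t = "\<lambda>i j. \<phi> (G $ i) * \<phi> (H $ j) * g ^ (i + j)"
  have "(fps_eval \<phi> g G * fps_eval \<phi> g H) $ n
      = ((\<Sum>i\<le>n. \<phi> (G $ i) * g ^ i) * (\<Sum>j\<le>n. \<phi> (H $ j) * g ^ j)) $ n"
    by (simp add: fps_mult_nth fps_eval_nth[OF g, where N = n])
  also have "\<dots> = (\<Sum>(i, j)\<in>{..n} \<times> {..n}. ?t i j $ n)"
    by (simp add: sum_product sum.cartesian_product fps_sum_nth power_add ac_simps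
        case_prod_beta)
  also have "\<dots> = (\<Sum>(i, j)\<in>{(i, j). i + j \<le> n}. ?t i j $ n)"
    by (rule sum_eq_sum_triangle) (auto simp: fps_mult_power_nth_eq_0[OF g])
  also have "\<dots> = (\<Sum>s\<le>n. \<Sum>i\<le>s. ?t i (s - i) $ n)"
    by (rule sum.triangle_reindex_eq)
  also have "\<dots> = (\<Sum>s\<le>n. (\<phi> ((G * H) $ s) * g ^ s) $ n)"
    by (intro sum.cong)
       (auto simp: fps_mult_nth unital_ring_homD[OF hom] sum_distrib_right fps_sum_nth atLeast0AtMost)
  finally show "fps_eval \<phi> g (G * H) $ n = (fps_eval \<phi> g G * fps_eval \<phi> g H) $ n"
    by (simp add: fps_eval_def)
qed

lemma unital_ring_hom_fps_eval:
  assumes "unital_ring_hom \<phi>" "g $ 0 = 0"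
  shows "unital_ring_hom (fps_eval \<phi> g)"
  unfolding unital_ring_hom_def
proof (intro conjI allI)
  show "fps_eval \<phi> g 1 = 1"
    using fps_eval_const[OF assms(1), of g 1] by (simp add: unital_ring_homD[OF assms(1)])
  show "fps_eval \<phi> g (G + H) = fps_eval \<phi> g G + fps_eval \<phi> g H" for G H
    by (rule fps_ext)
       (simp add: fps_eval_def unital_ring_homD[OF assms(1)] distrib_right sum.distrib)
  show "fps_eval \<phi> g (G * H) = fps_eval \<phi> g G * fps_eval \<phi> g H" for G H
    by (rule fps_eval_mult[OF assms])
qed

text \<open>
  This identification makes \<open>F \<mapsto> F(g,h)\<close> a ring homomorphism in \<open>F\<close>.
\<close>

lemma subst_fps1_eq_fps_eval:
  assumes g: "g $ 0 = 0" and h: "h $ 0 = 0"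
  shows "subst_fps1 F g h = fps_eval (fps_eval fps_const h) g F"
proof (rule fps_ext)
  fix n
  have vanish: "(g ^ i * h ^ j) $ n = 0" if "n < i + j" for i j
  proof -
    have coeff: "(g ^ i * h ^ j) $ n = (\<Sum>k\<le>n. (g ^ i) $ k * (h ^ j) $ (n - k))"
      by (simp add: fps_mult_nth atLeast0AtMost)
    have "(g ^ i) $ k * (h ^ j) $ (n - k) = 0" if "k \<le> n" for k
      using \<open>n < i + j\<close> that startsby_zero_power_prefix[OF g, rule_format, of k i]
        startsby_zero_power_prefix[OF h, rule_format, of "n - k" j]
      by (cases "k < i") auto
    then show ?thesis unfolding coeff by simp
  qed
  have "fps_eval (fps_eval fps_const h) g F $ n
      = (\<Sum>i\<le>n. (fps_eval fps_const h (F $ i) * g ^ i) $ n)"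
    by (simp add: fps_eval_def)
  also have "\<dots> = (\<Sum>i\<le>n. ((\<Sum>j\<le>n. fps_const (F $ i $ j) * h ^ j) * g ^ i) $ n)"
    by (simp only: fps_mult_nth[of _ _ n])
       (auto intro!: sum.cong simp: fps_eval_nth[OF h, where N = n])
  also have "\<dots> = (\<Sum>(i, j)\<in>{..n} \<times> {..n}. F $ i $ j * (g ^ i * h ^ j) $ n)"
    by (simp add: sum_distrib_right sum.cartesian_product fps_sum_nth mult.assoc)
       (simp add: mult.commute)
  also have "\<dots> = (\<Sum>(i, j)\<in>{(i, j). i + j \<le> n}. F $ i $ j * (g ^ i * h ^ j) $ n)"
    by (rule sum_eq_sum_triangle) (auto simp: vanish)
  finally show "subst_fps1 F g h $ n = fps_eval (fps_eval fps_const h) g F $ n"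
    by (simp add: subst_fps1_def)
qed

section \<open>Filtrations by degree\<close>

text \<open>
  \<open>D d a\<close> means that \<open>a\<close> has degree at least \<open>d\<close>. The filtration of a power series ring by total
  degree is built up one variable at a time, starting from the trivial filtration of the coefficient
  ring, so a single step from \<open>R\<close> to \<open>R[[x]]\<close> suffices for any number of variables.
\<close>

locale multiplicative_filtration =
  fixes D :: "nat \<Rightarrow> 'b::comm_ring_1 \<Rightarrow> bool"
  assumes level_0: "D 0 a"
    and zero: "D d 0"
    and add: "D d a \<Longrightarrow> D d b \<Longrightarrow> D d (a + b)"
    and mult: "D d a \<Longrightarrow> D e b \<Longrightarrow> D (d + e) (a * b)"
    and antimono: "D e a \<Longrightarrow> d \<le> e \<Longrightarrow> D d a"
begin

lemma sum: "(\<And>i. i \<in> A \<Longrightarrow> D d (f i)) \<Longrightarrow> D d (sum f A)"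
  by (induction A rule: infinite_finite_induct) (simp_all add: zero add)

lemma power: "D 1 a \<Longrightarrow> D n (a ^ n)"
proof (induction n)
  case 0
  show ?case by (rule level_0)
next
  case (Suc n)
  then show ?case using mult[of 1 a n "a ^ n"] by simp
qed

end

definition trivial_filtration :: "nat \<Rightarrow> 'b::comm_ring_1 \<Rightarrow> bool" where
  "trivial_filtration d a \<longleftrightarrow> d = 0 \<or> a = 0"

definition fps_filtration :: "(nat \<Rightarrow> 'b::comm_ring_1 \<Rightarrow> bool) \<Rightarrow> nat \<Rightarrow> 'b fps \<Rightarrow> bool" where
  "fps_filtration D d G \<longleftrightarrow> (\<forall>i. D (d - i) (G $ i))"

lemma multiplicative_filtration_trivial: "multiplicative_filtration trivial_filtration"
  by unfold_locales (auto simp: trivial_filtration_def)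

lemma multiplicative_filtration_fps:
  assumes "multiplicative_filtration D"
  shows "multiplicative_filtration (fps_filtration D)"
proof -
  interpret D: multiplicative_filtration D by (rule assms)
  show ?thesis
  proof
    fix a show "fps_filtration D 0 a" by (simp add: fps_filtration_def D.level_0)
  next
    fix d show "fps_filtration D d 0" by (simp add: fps_filtration_def D.zero)
  next
    fix d a b assume "fps_filtration D d a" "fps_filtration D d b"
    then show "fps_filtration D d (a + b)" by (simp add: fps_filtration_def D.add)
  next
    fix d e a b assume a: "fps_filtration D d a" and b: "fps_filtration D e b"
    show "fps_filtration D (d + e) (a * b)"
      unfolding fps_filtration_def fps_mult_nth
    proof (intro allI D.sum)
      fix n i :: nat assume "i \<in> {0..n}"
      then have "d + e - n \<le> (d - i) + (e - (n - i))" by auto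
      moreover have "D ((d - i) + (e - (n - i))) (a $ i * b $ (n - i))"
        using a b by (intro D.mult) (simp_all add: fps_filtration_def)
      ultimately show "D (d + e - n) (a $ i * b $ (n - i))"
        by (rule D.antimono[rotated])
    qed
  next
    fix e d :: nat and a assume a: "fps_filtration D e a" and "d \<le> e"
    show "fps_filtration D d a"
      unfolding fps_filtration_def
    proof
      fix i
      have "D (e - i) (a $ i)" using a by (simp add: fps_filtration_def)
      then show "D (d - i) (a $ i)" by (rule D.antimono) (use \<open>d \<le> e\<close> in simp)
    qed
  qed
qed

abbreviation "order_ge \<equiv> fps_filtration trivial_filtration"

lemma order_ge_iff: "order_ge d f \<longleftrightarrow> (\<forall>n<d. f $ n = 0)"
proof -
  have "d - n = 0 \<longleftrightarrow> \<not> n < d" for n by linarith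
  then show ?thesis unfolding fps_filtration_def trivial_filtration_def by blast
qed

text \<open>
  Continuity of evaluation: a coefficient \<open>G\<^sub>i\<close> of degree at least \<open>d - i\<close> is sent by \<open>\<phi>\<close> to a series of
  order at least \<open>d - i\<close>, and \<open>g\<^sup>i\<close> makes up for the missing \<open>i\<close>. The hypothesis on \<open>\<phi>\<close> has the
  same form as the conclusion, so the lemma can be iterated over the variables.
\<close>

lemma fps_eval_filtration:
  assumes \<phi>: "\<And>d a. D d a \<Longrightarrow> order_ge d (\<phi> a)"
    and g: "g $ 0 = 0" and G: "fps_filtration D d G"
  shows "order_ge d (fps_eval \<phi> g G)"
proof -
  have filt: "multiplicative_filtration (order_ge :: nat \<Rightarrow> 'b fps \<Rightarrow> bool)"
    by (intro multiplicative_filtration_fps multiplicative_filtration_trivial)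
  have "order_ge d (\<phi> (G $ i) * g ^ i)" for i
  proof -
    have "order_ge (d - i) (\<phi> (G $ i))"
      by (rule \<phi>) (use G in \<open>simp add: fps_filtration_def\<close>)
    moreover have "order_ge i (g ^ i)"
      by (rule multiplicative_filtration.power[OF filt]) (use g in \<open>auto simp: order_ge_iff\<close>)
    ultimately have "order_ge ((d - i) + i) (\<phi> (G $ i) * g ^ i)"
      by (rule multiplicative_filtration.mult[OF filt])
    then show ?thesis by (auto simp: order_ge_iff)
  qed
  then show ?thesis
    by (auto simp: order_ge_iff fps_eval_def intro!: sum.neutral)
qed

abbreviation "total_degree_ge \<equiv>
  fps_filtration (fps_filtration (fps_filtration trivial_filtration))"

lemma total_degree_ge_iff:
  "total_degree_ge d G \<longleftrightarrow> (\<forall>l m n. l + m + n < d \<longrightarrow> G $ l $ m $ n = 0)"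
proof -
  have "d - l - m - n = 0 \<longleftrightarrow> \<not> l + m + n < d" for l m n by linarith
  then show ?thesis unfolding fps_filtration_def trivial_filtration_def by blast
qed

section \<open>Evaluation in three variables\<close>

definition eval3 :: "'a::comm_ring_1 fps \<Rightarrow> 'a fps \<Rightarrow> 'a fps \<Rightarrow> 'a fps fps fps \<Rightarrow> 'a fps" where
  "eval3 f g h = fps_eval (fps_eval (fps_eval fps_const h) g) f"

context
  fixes f g h :: "'a::comm_ring_1 fps"
  assumes f: "f $ 0 = 0" and g: "g $ 0 = 0" and h: "h $ 0 = 0"
begin

lemma unital_ring_hom_eval3: "unital_ring_hom (eval3 f g h)"
  unfolding eval3_def
  by (intro unital_ring_hom_fps_eval unital_ring_hom_fps_const f g h)

lemma eval3_simps:
  "eval3 f g h fps_X = f"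
  "eval3 f g h (fps_const fps_X) = g"
  "eval3 f g h (fps_const (fps_const fps_X)) = h"
  "eval3 f g h (fps_const (fps_const (fps_const c))) = fps_const c"
  by (simp_all add: eval3_def f g h fps_eval_X fps_eval_const unital_ring_hom_fps_eval
        unital_ring_hom_fps_const)

lemma eval3_order_ge:
  assumes "total_degree_ge d G"
  shows "order_ge d (eval3 f g h G)"
proof -
  have 0: "order_ge e (fps_const a)" if "trivial_filtration e a" for e and a :: 'a
    using that by (auto simp: order_ge_iff trivial_filtration_def)
  have 1: "order_ge e (fps_eval fps_const h p)" if "order_ge e p" for e p
    by (rule fps_eval_filtration[OF 0 h that])
  have 2: "order_ge e (fps_eval (fps_eval fps_const h) g q)" if "fps_filtration order_ge e q" for e q
    by (rule fps_eval_filtration[OF 1 g that])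
  show ?thesis
    unfolding eval3_def by (rule fps_eval_filtration[OF 2 f assms])
qed

text \<open>
  A ring homomorphism commutes with the finite sum \<open>P\<close> of the terms with \<open>i + j \<le> n\<close>. The
  remaining terms have total degree greater than \<open>n\<close>, so by continuity they do not reach the
  coefficient of \<open>t\<^sup>n\<close>.
\<close>

lemma eval3_subst_fps3:
  assumes u: "u $ 0 $ 0 $ 0 = 0" and v: "v $ 0 $ 0 $ 0 = 0"
  shows "eval3 f g h (subst_fps3 F u v) = subst_fps1 F (eval3 f g h u) (eval3 f g h v)"
proof (rule fps_ext)
  fix n
  let ?S = "\<lambda>n. {(i, j). i + j \<le> (n::nat)}"
  define P where "P = (\<Sum>(i, j)\<in>?S n. fps_const (fps_const (fps_const (F $ i $ j))) * (u ^ i * v ^ j))"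
  have fin: "finite (?S k)" for k
    by (rule finite_subset[of _ "{..k} \<times> {..k}"]) auto
  have filt: "multiplicative_filtration (total_degree_ge :: nat \<Rightarrow> 'a fps fps fps \<Rightarrow> bool)"
    by (intro multiplicative_filtration_fps multiplicative_filtration_trivial)
  have uv: "total_degree_ge (i + j) (u ^ i * v ^ j)" for i j
  proof -
    have "total_degree_ge i (u ^ i)" "total_degree_ge j (v ^ j)"
      by (rule multiplicative_filtration.power[OF filt]; use u v in \<open>simp add: total_degree_ge_iff\<close>)+
    then show ?thesis by (rule multiplicative_filtration.mult[OF filt])
  qed
  have "total_degree_ge (Suc n) (subst_fps3 F u v - P)"
    unfolding total_degree_ge_iff
  proof (intro allI impI)
    fix l m k assume lmk: "l + m + k < Suc n"
    have "P $ l $ m $ k = (\<Sum>(i, j)\<in>?S n. F $ i $ j * (u ^ i * v ^ j) $ l $ m $ k)"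
      by (simp add: P_def fps_sum_nth case_prod_beta)
    also have "\<dots> = (\<Sum>(i, j)\<in>?S (l + m + k). F $ i $ j * (u ^ i * v ^ j) $ l $ m $ k)"
      using lmk uv[unfolded total_degree_ge_iff]
      by (intro sum_eq_sum_triangle fin) auto
    finally show "(subst_fps3 F u v - P) $ l $ m $ k = 0"
      by (simp add: subst_fps3_def)
  qed
  then have "eval3 f g h (subst_fps3 F u v - P) $ n = 0"
    using eval3_order_ge by (auto simp: order_ge_iff)
  moreover have "eval3 f g h (subst_fps3 F u v)
      = eval3 f g h (subst_fps3 F u v - P) + eval3 f g h P"
    by (subst unital_ring_homD(3)[OF unital_ring_hom_eval3, symmetric]) simp
  moreover have "eval3 f g h P $ n = subst_fps1 F (eval3 f g h u) (eval3 f g h v) $ n"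
    by (simp add: P_def subst_fps1_def unital_ring_homD[OF unital_ring_hom_eval3] eval3_simps
        fps_sum_nth case_prod_beta)
  ultimately show "eval3 f g h (subst_fps3 F u v) $ n
      = subst_fps1 F (eval3 f g h u) (eval3 f g h v) $ n"
    by simp
qed

end

section \<open>Formal group laws act on series without constant term\<close>

lemma formal_group_law_coeffs:
  assumes "formal_group_law F"
  shows "F $ 0 $ 0 = 0" "F $ 0 $ 1 = 1"
proof -
  obtain a b c where "F - (fps_X + fps_const fps_X)
      = a * fps_X\<^sup>2 + b * (fps_X * fps_const fps_X) + c * (fps_const fps_X)\<^sup>2"
    using assms by (auto simp: formal_group_law_def ideal_xy_squared_def Let_def)
  then have F: "F = fps_X + fps_const fps_X + a * fps_X\<^sup>2
      + b * (fps_X * fps_const fps_X) + c * (fps_const fps_X)\<^sup>2"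
    by (simp add: algebra_simps)
  show "F $ 0 $ 0 = 0" by (simp add: F power2_eq_square)
  show "F $ 0 $ 1 = 1" by (simp add: F power2_eq_square fps_mult_nth)
qed

text \<open>
  The evaluation homomorphism at \<open>(f, g, h)\<close> carries the associativity law of \<open>F\<close> to this identity.
\<close>

lemma subst_fps1_assoc:
  assumes F: "formal_group_law F"
    and f: "f $ 0 = 0" and g: "g $ 0 = 0" and h: "h $ 0 = 0"
  shows "subst_fps1 F (subst_fps1 F f g) h = subst_fps1 F f (subst_fps1 F g h)"
proof -
  let ?x = "fps_X :: 'a fps fps fps" and ?y = "fps_const fps_X :: 'a fps fps fps"
    and ?z = "fps_const (fps_const fps_X) :: 'a fps fps fps"
  have "subst_fps3 F (subst_fps3 F ?x ?y) ?z = subst_fps3 F ?x (subst_fps3 F ?y ?z)"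
    using F by (simp add: formal_group_law_def Let_def)
  then have "eval3 f g h (subst_fps3 F (subst_fps3 F ?x ?y) ?z)
      = eval3 f g h (subst_fps3 F ?x (subst_fps3 F ?y ?z))"
    by simp
  moreover have "subst_fps3 F u v $ 0 $ 0 $ 0 = 0" for u v
    using formal_group_law_coeffs(1)[OF F] by (simp add: subst_fps3_def)
  ultimately show ?thesis
    by (simp add: eval3_subst_fps3[OF f g h] eval3_simps[OF f g h])
qed

text \<open>
  The result of substituting into \<open>F(x,y) = F(0,y) + x G(x,y)\<close>.
\<close>

lemma subst_fps1_expand:
  assumes g: "g $ 0 = 0" and h: "h $ 0 = 0"
  shows "subst_fps1 F g h = fps_eval fps_const h (F $ 0) + g * subst_fps1 (fps_shift 1 F) g h"
proof -
  have hom: "unital_ring_hom (fps_eval fps_const h)"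
    by (rule unital_ring_hom_fps_eval[OF unital_ring_hom_fps_const h])
  have "F = fps_const (F $ 0) + fps_X * fps_shift 1 F"
    by (rule fps_ext) auto
  then have "subst_fps1 F g h = subst_fps1 (fps_const (F $ 0) + fps_X * fps_shift 1 F) g h"
    by simp
  also have "\<dots> = fps_eval fps_const h (F $ 0) + g * subst_fps1 (fps_shift 1 F) g h"
    by (simp add: subst_fps1_eq_fps_eval[OF g h] unital_ring_homD[OF unital_ring_hom_fps_eval[OF hom g]]
        fps_eval_const[OF hom] fps_eval_X[OF hom g])
  finally show ?thesis .
qed

text \<open>
  Write \<open>d = p - t\<close>; then \<open>p(p) = p\<close> says \<open>d(p) = 0\<close>. As \<open>p = t + \<dots>\<close>, the lowest term of \<open>d(p)\<close> is
  that of \<open>d\<close>, so \<open>d\<close> has none.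
\<close>

lemma idempotent_fps_eq_X:
  fixes p :: "'a::comm_ring_1 fps"
  assumes "p $ 0 = 0" "p $ 1 = 1" and idem: "fps_eval fps_const p p = p"
  shows "p = fps_X"
proof -
  define d where "d = p - fps_X"
  have hom: "unital_ring_hom (fps_eval fps_const p)"
    by (rule unital_ring_hom_fps_eval[OF unital_ring_hom_fps_const assms(1)])
  have "fps_eval fps_const p (d + fps_X) = p" using idem by (simp add: d_def)
  then have zero: "fps_eval fps_const p d = 0"
    by (simp add: unital_ring_homD[OF hom] fps_eval_X[OF unital_ring_hom_fps_const assms(1)])
  \<comment> \<open>Once the lower coefficients of \<open>d\<close> vanish, the coefficient of \<open>t\<^sup>n\<close> in \<open>d(p)\<close> is \<open>d\<^sub>n\<close>.\<close>
  have "d $ n = 0" for n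
  proof (induction n rule: less_induct)
    case (less n)
    have "0 = (\<Sum>i\<le>n. d $ i * (p ^ i) $ n)"
      using arg_cong[OF zero, of "\<lambda>q. q $ n"] by (simp add: fps_eval_def)
    also have "\<dots> = (\<Sum>i\<in>{n}. d $ i * (p ^ i) $ n)"
      by (rule sum.mono_neutral_right) (auto simp: less)
    also have "\<dots> = d $ n"
      using startsby_zero_power_nth_same[OF assms(1), of n] assms(2) by simp
    finally show ?case by simp
  qed
  then have "d = 0" by (intro fps_ext) simp
  then show ?thesis by (simp add: d_def)
qed

text \<open>
  Associativity at \<open>(0, 0, t)\<close> makes \<open>F(0,y)\<close> idempotent under composition.
\<close>

lemma formal_group_law_left_unit:
  assumes F: "formal_group_law F"
  shows "F $ 0 = fps_X"
proof (rule idempotent_fps_eq_X)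
  let ?p = "F $ 0"
  show p0: "?p $ 0 = 0" and "?p $ 1 = 1" using formal_group_law_coeffs[OF F] by auto
  have left: "subst_fps1 F 0 h = fps_eval fps_const h ?p" if "h $ 0 = 0" for h
    using subst_fps1_expand[of 0 h F] that by simp
  have X: "fps_eval fps_const fps_X q = q" for q :: "'a fps"
    by (rule fps_ext) (simp add: fps_eval_def if_distrib[of "(*) _"] cong: if_cong)
  have "fps_eval fps_const 0 ?p = 0"
    by (rule fps_ext) (auto simp: fps_eval_def power_0_left p0 if_distrib cong: if_cong)
  then have "subst_fps1 F 0 0 = 0" by (simp add: left)
  then show "fps_eval fps_const ?p ?p = ?p"
    using subst_fps1_assoc[OF F, of 0 0 fps_X] p0 by (simp add: left X)
qed

lemma subst_fps1_zero_left:
  assumes "formal_group_law F" "h $ 0 = 0"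
  shows "subst_fps1 F 0 h = h"
  using subst_fps1_expand[of 0 h F] assms
  by (simp add: formal_group_law_left_unit fps_eval_X unital_ring_hom_fps_const)

lemma dvd_subst_fps1_diff:
  assumes "formal_group_law F" "g $ 0 = 0" "h $ 0 = 0"
  shows "g dvd subst_fps1 F g h - h"
  using subst_fps1_expand[of g h F] assms
  by (simp add: formal_group_law_left_unit fps_eval_X unital_ring_hom_fps_const)

section \<open>The series of multiples and its divisibility properties\<close>

text \<open>
  At \<open>n = 0\<close>, which the recursion treats separately, this is the left unit law.
\<close>

lemma fgl_mult_Suc:
  assumes "formal_group_law F"
  shows "fgl_mult F (Suc n) = subst_fps1 F (fgl_mult F n) fps_X"
  using assms by (cases n) (auto simp: subst_fps1_zero_left)

text \<open>
  Associativity moves the brackets of \<open>(\<dots>(t +\<^sub>F t) +\<^sub>F \<dots>) +\<^sub>F t\<close>, one summand \<open>t\<close> at a time from the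
  right. The base case \<open>[m + 1] = [m] +\<^sub>F t\<close> is why the second summand starts at \<open>[1]\<close>.
\<close>

lemma fgl_mult_add:
  assumes F: "formal_group_law F"
  shows "fgl_mult F (m + Suc n) = subst_fps1 F (fgl_mult F m) (fgl_mult F (Suc n))"
proof (induction n)
  case 0
  show ?case using fgl_mult_Suc[OF F, of m] by simp
next
  case (Suc n)
  have "fgl_mult F (m + Suc (Suc n)) = subst_fps1 F (fgl_mult F (m + Suc n)) fps_X"
    using fgl_mult_Suc[OF F, of "m + Suc n"] by simp
  also have "\<dots> = subst_fps1 F (fgl_mult F m) (subst_fps1 F (fgl_mult F (Suc n)) fps_X)"
    unfolding Suc.IH by (rule subst_fps1_assoc[OF F]) (simp_all add: fgl_mult_nth_0[OF F])
  finally show ?case by simp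
qed

lemma fgl_mult_diff_dvd:
  assumes F: "formal_group_law F" and "0 < k" "k < n"
  shows "fgl_mult F (n - k) dvd fgl_mult F n - fgl_mult F k"
proof -
  obtain k' where k: "k = Suc k'" using \<open>0 < k\<close> by (cases k) auto
  have "fgl_mult F n = subst_fps1 F (fgl_mult F (n - k)) (fgl_mult F k)"
    using fgl_mult_add[OF F, of "n - k" k'] \<open>k < n\<close> k by simp
  then show ?thesis by (simp add: dvd_subst_fps1_diff[OF F] fgl_mult_nth_0[OF F])
qed

lemma fps_X_mult_left_cancel:
  fixes a b :: "'a::comm_ring_1 fps"
  assumes "fps_X * a = fps_X * b"
  shows "a = b"
proof (rule fps_ext)
  fix n
  show "a $ n = b $ n" using arg_cong[OF assms, of "\<lambda>q. q $ Suc n"] by simp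
qed

theorem proposition4p3p4:
  fixes F :: "'a::comm_ring_1 fps fps"
  assumes "formal_group_law F"
    and "\<And>n. n > 0 \<Longrightarrow> non_zero_divisor (fgl_mult F n)"
  shows "generalized_n_series (\<lambda>n. fgl_mult F n) \<and> generalized_n_series (\<lambda>n. fgl_angle F n)"
proof
  note F = assms(1) and X = fps_X_mult_fgl_angle[OF assms(1)]
  show "generalized_n_series (\<lambda>n. fgl_mult F n)"
    using assms(2) fgl_mult_diff_dvd[OF F] by (auto simp: generalized_n_series_def)
  show "generalized_n_series (\<lambda>n. fgl_angle F n)"
    unfolding generalized_n_series_def
  proof (intro conjI allI impI)
    show "fgl_angle F 0 = 0" by (simp add: fgl_angle_def)
  next
    fix n :: nat assume "n > 0"
    show "non_zero_divisor (fgl_angle F n)"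
      unfolding non_zero_divisor_def
    proof (intro allI impI)
      fix b assume "fgl_angle F n * b = 0"
      then have "fgl_mult F n * b = 0" by (simp add: X[symmetric] mult.assoc)
      then show "b = 0" using assms(2)[OF \<open>n > 0\<close>] by (simp add: non_zero_divisor_def)
    qed
  next
    fix n k :: nat assume "k < n \<and> 0 < k"
    then obtain q where "fgl_mult F n - fgl_mult F k = fgl_mult F (n - k) * q"
      using fgl_mult_diff_dvd[OF F] by blast
    then have "fps_X * (fgl_angle F n - fgl_angle F k) = fps_X * (fgl_angle F (n - k) * q)"
      by (simp add: X[symmetric] algebra_simps)
    then have "fgl_angle F n - fgl_angle F k = fgl_angle F (n - k) * q"
      by (rule fps_X_mult_left_cancel)
    then show "fgl_angle F (n - k) dvd fgl_angle F n - fgl_angle F k" by simp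
  qed
qed

end
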